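(* Let $X=\{\Phi_{p_1,\theta_1}>0\}\cap\cdots\cap\{\Phi_{p_k,\theta_k}>0\}$ be the intersection of finitely many pairwise distinct open polynomial half planes. Then $X$ is a disjoint union of finitely many regions of type II.
   Context: For a real polynomial $p$ and angle $\theta$, $\Phi_{p,\theta}(x,y)=p(x\cos\theta+y\sin\theta)-(-x\sin\theta+y\cos\theta)$; $\{\Phi_{p,\theta}>0\}$ is an open polynomial half plane and $\{\Phi_{p,\theta}=0\}$ a rotated polynomial graph. A region of type I is a closed, connected, simply connected subset of $\mathbb{R}^2$ which is the closure of its interior and whose boundary is the union of finitely many arcs (sides), each contained in a rotated polynomial graph. A region of type II is the interior of a region of type I. *)

theory Defs
  imports "HOL-Analysis.Analysis" "HOL-Computational_Algebra.Polynomial"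
begin

definition Phi :: "real poly \<Rightarrow> real \<Rightarrow> real \<times> real \<Rightarrow> real" where
  "Phi p \<theta> z = poly p (fst z * cos \<theta> + snd z * sin \<theta>) - (- fst z * sin \<theta> + snd z * cos \<theta>)"

definition poly_half_plane :: "real poly \<Rightarrow> real \<Rightarrow> (real \<times> real) set" where
  "poly_half_plane p \<theta> = {z. Phi p \<theta> z > 0}"

definition rot_poly_graph :: "real poly \<Rightarrow> real \<Rightarrow> (real \<times> real) set" where
  "rot_poly_graph p \<theta> = {z. Phi p \<theta> z = 0}"

text \<open>An arc: a homeomorphic image of a non-degenerate real interval
  (possibly unbounded or non-closed, so that whole polynomial graphs count).\<close>
definition is_arc :: "(real \<times> real) set \<Rightarrow> bool" where
  "is_arc A \<longleftrightarrow> (\<exists>I :: real set. is_interval I \<and> (\<exists>a b. a \<in> I \<and> b \<in> I \<and> a \<noteq> b)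
                      \<and> I homeomorphic A)"

definition region_typeI :: "(real \<times> real) set \<Rightarrow> bool" where
  "region_typeI R \<longleftrightarrow> closed R \<and> connected R \<and> simply_connected R
     \<and> closure (interior R) = R
     \<and> (\<exists>S. finite S \<and> frontier R = \<Union>S
            \<and> (\<forall>A\<in>S. is_arc A \<and> (\<exists>p \<theta>. A \<subseteq> rot_poly_graph p \<theta>)))"

definition region_typeII :: "(real \<times> real) set \<Rightarrow> bool" where
  "region_typeII U \<longleftrightarrow> (\<exists>R. region_typeI R \<and> U = interior R)"

end

theory Submission
  imports Defs "HOL-Complex_Analysis.Riemann_Mapping"
begin

text \<open>
  The regions are the components \<open>U\<close> of \<open>X\<close>. A rotation followed by a shear maps each half plane to
  the upper half plane. Two different half planes with a common point have different graphs, and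
  these meet in finitely many points, because the function that defines one is a polynomial along
  the other. Near a frontier point that lies on only one graph, \<open>X\<close> is a half disc; hence each piece
  of a graph between crossings borders at most one component, \<open>X\<close> has finitely many components, and
  the frontier of \<open>U\<close> is a finite union of closed arcs that pairwise meet in finite sets.

  Such a frontier is an ANR, and so is \<open>R = closure U\<close>, since \<open>R\<close> and \<open>- U\<close> are closed with union the
  plane and intersection the frontier. All components of \<open>- R\<close> are unbounded: a bounded one would lie
  in \<open>X\<close>, but across each of its edges lies \<open>U\<close>. So every loop in \<open>R\<close> contracts inside a simply
  connected subset of a neighbourhood of \<open>R\<close>, and a retraction of that neighbourhood onto \<open>R\<close> carries
  the contraction back to \<open>R\<close>.
\<close>

subsection \<open>Simple connectivity of closed planar ANRs\<close>

lemma simply_connected_bounded_open_2D: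
  fixes S :: "'a::euclidean_space set"
  assumes "DIM('a) = 2" "open S" "bounded S" "connected S" "connected (- S)"
  shows "simply_connected S"
proof -
  obtain f :: "'a \<Rightarrow> complex" and g where f: "linear f" and "\<And>x. g (f x) = x" "\<And>y. f (g y) = y"
    by (rule isomorphisms_UNIV_UNIV[where 'M = 'a and 'N = complex])
      (simp only: assms(1) DIM_complex, blast)
  then have bij: "bij f"
    by (metis bijI')
  have "- f ` S = f ` (- S)"
    by (simp add: bij bij_image_Compl_eq)
  then have "simply_connected (f ` S)"
    using assms f bij
    by (simp add: simply_connected_iff_simple connected_linear_image bounded_linear_image
        linear_conv_bounded_linear[symmetric] open_bijective_linear_image_eq)
  then show ?thesis
    using linear_homeomorphic_image[OF f bij_is_inj[OF bij]] homeomorphic_simply_connected_eq by blast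
qed

lemma obtain_continuum_in_open_connected:
  fixes W :: "'a::euclidean_space set"
  assumes "open W" "connected W" "x \<in> W" "y \<in> W"
  obtains D where "compact D" "connected D" "D \<subseteq> W" "x \<in> interior D" "y \<in> D"
proof -
  obtain q where q: "path q" "path_image q \<subseteq> W" "pathstart q = x" "pathfinish q = y"
    using connected_open_path_connected[OF assms(1,2)] assms(3,4) by (metis path_connected_def)
  obtain e where e: "e > 0" "cball x e \<subseteq> W"
    using assms(1,3) open_contains_cball by blast
  show ?thesis
  proof
    show "compact (cball x e \<union> path_image q)"
      by (simp add: compact_Un compact_path_image q(1))
    have "x \<in> cball x e" "x \<in> path_image q"
      using e(1) q(3) pathstart_in_path_image[of q] by simp_all
    then have "cball x e \<inter> path_image q \<noteq> {}"
      by blast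
    then show "connected (cball x e \<union> path_image q)"
      using q(1) by (intro connected_Un connected_cball connected_path_image)
    show "cball x e \<union> path_image q \<subseteq> W"
      using e(2) q(2) by blast
    show "x \<in> interior (cball x e \<union> path_image q)"
      using e(1) interior_mono[of "cball x e" "cball x e \<union> path_image q"] by auto
    show "y \<in> cball x e \<union> path_image q"
      using q(4) pathfinish_in_path_image[of q] by simp
  qed
qed

lemma obtain_continuum_leaving_bounded:
  fixes R :: "'a::euclidean_space set"
  assumes "closed R" "x \<notin> R" "bounded B" and unbounded: "\<And>C. C \<in> components (- R) \<Longrightarrow> \<not> bounded C"
  obtains D where "compact D" "connected D" "D \<inter> R = {}" "- B \<inter> D \<noteq> {}" "x \<in> interior D"
proof -
  have "x \<in> - R"
    using assms(2) by simp
  then obtain W where W: "W \<in> components (- R)" "x \<in> W"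
    by (metis UnionE Union_components)
  obtain y where y: "y \<in> W" "y \<notin> B"
    using unbounded[OF W(1)] assms(3) by (meson bounded_subset subsetI)
  have "open W" "connected W"
    using W(1) assms(1) open_components in_components_connected by blast+
  then obtain D where D: "compact D" "connected D" "D \<subseteq> W" "x \<in> interior D" "y \<in> D"
    using W(2) y(1) by (rule obtain_continuum_in_open_connected)
  then have "D \<inter> R = {}" "- B \<inter> D \<noteq> {}"
    using in_components_subset[OF W(1)] y(2) by auto
  then show ?thesis
    using that D by blast
qed

lemma connected_Un_UN:
  assumes "connected B" "\<And>x. x \<in> T \<Longrightarrow> connected (D x)" "\<And>x. x \<in> T \<Longrightarrow> B \<inter> D x \<noteq> {}"
  shows "connected (B \<union> (\<Union>x\<in>T. D x))"
proof (cases "T = {}")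
  case False
  have "connected (\<Union>x\<in>T. B \<union> D x)"
  proof (rule connected_Union)
    show "connected S" if "S \<in> (\<lambda>x. B \<union> D x) ` T" for S
      using that assms by (auto intro!: connected_Un)
    show "\<Inter>((\<lambda>x. B \<union> D x) ` T) \<noteq> {}"
      using False assms(3) by blast
  qed
  then show ?thesis
    using False by (simp add: UN_Un_distrib)
qed (simp add: assms(1))

lemma obtain_closed_connected_avoiding:
  fixes R :: "'a::euclidean_space set"
  assumes dim: "2 \<le> DIM('a)" and "closed R" and unbounded: "\<And>C. C \<in> components (- R) \<Longrightarrow> \<not> bounded C"
    and F: "compact F" "F \<inter> R = {}"
  obtains S where "closed S" "connected S" "- ball 0 r \<union> F \<subseteq> S" "S \<inter> R \<subseteq> - ball 0 r"
proof -
  let ?B = "ball (0::'a) r"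
  have "\<exists>D. compact D \<and> connected D \<and> D \<inter> R = {} \<and> - ?B \<inter> D \<noteq> {} \<and> x \<in> interior D" if "x \<in> F" for x
  proof -
    have "x \<notin> R"
      using that F(2) by blast
    then show ?thesis
      using obtain_continuum_leaving_bounded[OF \<open>closed R\<close> _ bounded_ball unbounded] by metis
  qed
  then obtain D where D: "\<And>x. x \<in> F \<Longrightarrow> compact (D x) \<and> connected (D x) \<and> D x \<inter> R = {}
      \<and> - ?B \<inter> D x \<noteq> {} \<and> x \<in> interior (D x)"
    by metis
  obtain T where T: "T \<subseteq> F" "finite T" "F \<subseteq> (\<Union>x\<in>T. interior (D x))"
  proof (rule compactE_image[OF F(1)])
    show "F \<subseteq> (\<Union>x\<in>F. interior (D x))"
      using D by blast
  qed auto
  show ?thesis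
  proof
    show "closed (- ?B \<union> (\<Union>x\<in>T. D x))"
      using T(1,2) D by (intro closed_Un closed_UN) (auto simp: compact_imp_closed)
    have "connected (- ?B)"
      using dim by (simp add: connected_complement_bounded_convex)
    then show "connected (- ?B \<union> (\<Union>x\<in>T. D x))"
      using T(1) D by (intro connected_Un_UN) auto
    show "- ?B \<union> F \<subseteq> - ?B \<union> (\<Union>x\<in>T. D x)"
      using T(3) interior_subset by blast
    show "(- ?B \<union> (\<Union>x\<in>T. D x)) \<inter> R \<subseteq> - ?B"
      using T(1) D by blast
  qed
qed

lemma obtain_simply_connected_between:
  fixes R :: "'a::euclidean_space set"
  assumes dim: "DIM('a) = 2" and "closed R"
    and "\<And>C. C \<in> components (- R) \<Longrightarrow> \<not> bounded C"
    and "open N" "R \<subseteq> N" and K: "compact K" "connected K" "K \<subseteq> R" "K \<noteq> {}"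
  obtains M where "simply_connected M" "K \<subseteq> M" "M \<subseteq> N"
proof -
  obtain r where r: "K \<subseteq> ball 0 r"
    using K(1) by (metis bounded_subset_ballD compact_imp_bounded)
  obtain S where S: "closed S" "connected S" "- ball 0 r \<union> (cball 0 r - N) \<subseteq> S" "S \<inter> R \<subseteq> - ball 0 r"
    using obtain_closed_connected_avoiding[of R "cball 0 r - N" r] assms(1-5)
    by (auto simp: compact_diff)
  have "K \<subseteq> - S"
    using r S(4) K(3) by blast
  then obtain M where M: "M \<in> components (- S)" "K \<subseteq> M"
    using exists_component_superset[of K "- S"] K(2,4) by blast
  have "M \<subseteq> - S"
    using M(1) in_components_subset by blast
  then have "M \<subseteq> ball 0 r" "M \<subseteq> N"
    using S(3) ball_subset_cball by blast+
  show ?thesis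
  proof
    show "simply_connected M"
    proof (rule simply_connected_bounded_open_2D[OF dim])
      show "open M"
        using M(1) S(1) open_components by blast
      show "bounded M"
        using \<open>M \<subseteq> ball 0 r\<close> bounded_ball bounded_subset by blast
      show "connected M"
        using M(1) by (rule in_components_connected)
      show "connected (- M)"
        using S(2) M(1) by (rule component_complement_connected)
    qed
  qed fact+
qed

lemma ANR_path_connected_iff_connected:
  fixes S :: "'a::euclidean_space set"
  assumes "ANR S"
  shows "path_connected S \<longleftrightarrow> connected S"
  using path_component_eq_connected_component[OF ANR_imp_locally_path_connected[OF assms]]
  by (simp add: path_connected_component connected_iff_connected_component)

lemma simply_connected_closed_ANR_2D:
  fixes R :: "'a::euclidean_space set"
  assumes "DIM('a) = 2" "closed R" "connected R" "ANR R"
    and "\<And>C. C \<in> components (- R) \<Longrightarrow> \<not> bounded C"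
  shows "simply_connected R"
  unfolding simply_connected_eq_contractible_loop_some
proof (intro conjI allI impI)
  show "path_connected R"
    using assms(3,4) by (simp add: ANR_path_connected_iff_connected)
next
  fix p :: "real \<Rightarrow> 'a"
  assume p: "path p \<and> path_image p \<subseteq> R \<and> pathfinish p = pathstart p"
  obtain N where N: "open N" "R retract_of N"
    using ANR_imp_absolute_neighbourhood_retract_UNIV[OF \<open>ANR R\<close> homeomorphic_refl \<open>closed R\<close>] .
  then obtain r where r: "R \<subseteq> N" "continuous_on N r" "r \<in> N \<rightarrow> R" "\<And>x. x \<in> R \<Longrightarrow> r x = x"
    by (auto simp: retract_of_def retraction_def)
  obtain M where M: "simply_connected M" "path_image p \<subseteq> M" "M \<subseteq> N"
    using obtain_simply_connected_between[OF assms(1,2,5) N(1) r(1), of "path_image p"] p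
    by (metis compact_path_image connected_path_image path_image_nonempty)
  define a where "a = pathstart p"
  have a: "a \<in> R" "a \<in> M"
    using p M(2) by (auto simp: a_def)
  have "homotopic_loops M p (linepath a a)"
    using M(1,2) p a(2) by (simp add: simply_connected_eq_contractible_loop_any)
  then have "homotopic_loops R (r \<circ> p) (r \<circ> linepath a a)"
    using r(2,3) M(3) by (intro homotopic_loops_continuous_image[of M]) (auto intro: continuous_on_subset)
  moreover have "r \<circ> linepath a a = linepath a a"
    using r(4) a(1) by (auto simp: linepath_def)
  moreover have "homotopic_loops R p (r \<circ> p)"
    using p r(4) by (intro homotopic_loops_eq) (auto simp: path_image_def image_subset_iff)
  ultimately show "\<exists>a. a \<in> R \<and> homotopic_loops R p (linepath a a)"
    using a(1) by (metis homotopic_loops_trans)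
qed

lemma ANR_Union_finite_Int:
  fixes \<A> :: "'a::euclidean_space set set"
  assumes "finite \<A>" "\<And>A. A \<in> \<A> \<Longrightarrow> closed A" "\<And>A. A \<in> \<A> \<Longrightarrow> ANR A"
    and "\<And>A B. \<lbrakk>A \<in> \<A>; B \<in> \<A>; A \<noteq> B\<rbrakk> \<Longrightarrow> finite (A \<inter> B)"
  shows "ANR (\<Union>\<A>)"
  using assms
proof (induction \<A>)
  case (insert A \<A>)
  have "finite (\<Union>B\<in>\<A>. A \<inter> B)"
    using insert.hyps insert.prems(3) by (intro finite_UN_I) auto
  then have "finite (A \<inter> \<Union>\<A>)"
    by (simp only: Int_Union)
  then show ?case
    using insert by (auto intro!: ANR_closed_Un finite_imp_ANR[of "A \<inter> \<Union>\<A>"])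
qed simp

lemma is_arc_imp_ANR:
  assumes "is_arc A"
  shows "ANR A"
  using assms convex_imp_ANR homeomorphic_ANR_iff_ANR is_interval_convex unfolding is_arc_def by metis

subsection \<open>Regular open sets\<close>

definition regular_open :: "'a::topological_space set \<Rightarrow> bool" where
  "regular_open U \<longleftrightarrow> interior (closure U) = U"

lemma regular_openI: "\<lbrakk>open U; interior (closure U) \<subseteq> U\<rbrakk> \<Longrightarrow> regular_open U"
  by (simp add: regular_open_def closure_subset interior_maximal subset_antisym)

lemma regular_open_imp_open: "regular_open U \<Longrightarrow> open U"
  by (metis regular_open_def open_interior)

lemma regular_open_greaterThan: "regular_open {a::real<..}"
  by (simp add: regular_open_def)

lemma frontier_closure_regular_open: "regular_open U \<Longrightarrow> frontier (closure U) = frontier U"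
  by (simp add: frontier_def regular_open_def regular_open_imp_open interior_open)

lemma regular_open_Compl_closure: "regular_open U \<Longrightarrow> regular_open (- closure U)"
  by (simp add: regular_open_def closure_complement interior_complement)

lemma regular_open_INT:
  assumes "finite I" "\<And>i. i \<in> I \<Longrightarrow> regular_open (A i)"
  shows "regular_open (\<Inter>i\<in>I. A i)"
proof (rule regular_openI)
  show "open (\<Inter>i\<in>I. A i)"
    using assms by (simp add: open_INT regular_open_imp_open)
  have "interior (closure (\<Inter>i\<in>I. A i)) \<subseteq> interior (closure (A i))" if "i \<in> I" for i
    using that by (intro interior_mono closure_mono) blast
  then show "interior (closure (\<Inter>i\<in>I. A i)) \<subseteq> (\<Inter>i\<in>I. A i)"
    using assms(2) by (auto simp: regular_open_def)
qed

lemma closure_vimage_open_map: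
  assumes "continuous_on UNIV f" "\<And>A. open A \<Longrightarrow> open (f ` A)"
  shows "closure (f -` T) = f -` closure T"
proof
  show "closure (f -` T) \<subseteq> f -` closure T"
    using assms(1) closure_subset by (intro closure_minimal closed_vimage) blast+
  show "f -` closure T \<subseteq> closure (f -` T)"
  proof
    fix z assume z: "z \<in> f -` closure T"
    have "f -` T \<inter> A \<noteq> {}" if A: "open A" "z \<in> A" for A
    proof -
      have "f ` A \<inter> closure T \<noteq> {}"
        using z A(2) by blast
      then have "f ` A \<inter> T \<noteq> {}"
        using assms(2)[OF A(1)] open_Int_closure_eq_empty by blast
      then show ?thesis
        by blast
    qed
    then show "z \<in> closure (f -` T)"
      unfolding closure_iff_nhds_not_empty by blast
  qed
qed

lemma interior_vimage_open_map:
  assumes "continuous_on UNIV f" "\<And>A. open A \<Longrightarrow> open (f ` A)"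
  shows "interior (f -` T) = f -` interior T"
  using closure_vimage_open_map[OF assms, of "- T"]
  by (simp add: closure_complement vimage_Compl)

lemma regular_open_vimage:
  assumes "continuous_on UNIV f" "\<And>A. open A \<Longrightarrow> open (f ` A)" "regular_open T"
  shows "regular_open (f -` T)"
  using assms by (simp add: regular_open_def closure_vimage_open_map interior_vimage_open_map)

lemma component_Int_closure:
  assumes "C \<in> components S"
  shows "S \<inter> closure C = C"
proof -
  obtain T where T: "closed T" "C = S \<inter> T"
    using closedin_component[OF assms] by (auto simp: closedin_closed)
  then have "closure C \<subseteq> T"
    by (simp add: closure_minimal)
  then show ?thesis
    using T(2) closure_subset by blast
qed

lemma regular_open_component:
  fixes S :: "'a::real_normed_vector set"
  assumes "regular_open S" "U \<in> components S"
  shows "regular_open U"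
proof (rule regular_openI)
  show "open U"
    using assms by (meson open_components regular_open_imp_open)
  have "interior (closure U) \<subseteq> interior (closure S)"
    using assms(2) by (intro interior_mono closure_mono in_components_subset)
  then show "interior (closure U) \<subseteq> U"
    using assms(1) component_Int_closure[OF assms(2)] interior_subset unfolding regular_open_def by blast
qed

text \<open>If \<open>z\<close> were isolated in the frontier, a punctured disc around \<open>z\<close> would lie in \<open>U\<close>, and then
  \<open>z\<close> itself would by regularity.\<close>

lemma regular_open_islimpt_frontier:
  fixes U :: "'a::euclidean_space set"
  assumes dim: "2 \<le> DIM('a)" and U: "regular_open U" and z: "z \<in> frontier U"
  shows "z islimpt frontier U"
proof (rule ccontr)
  assume "\<not> z islimpt frontier U"
  then obtain e where e: "e > 0" "\<And>x. \<lbrakk>x \<in> frontier U; x \<in> ball z e\<rbrakk> \<Longrightarrow> x = z"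
    by (auto simp: islimpt_approachable dist_commute)
  have z': "z \<in> closure U" "z \<notin> U"
    using z regular_open_imp_open[OF U] by (simp_all add: frontier_def interior_open)
  then have "(ball z e - {z}) \<inter> U \<noteq> {}"
    using e(1) unfolding closure_approachable by (metis DiffI IntI dist_commute empty_iff mem_ball singletonD)
  then have "ball z e - {z} \<subseteq> U"
    using connected_Int_frontier[OF connected_punctured_ball[OF dim]] e(2) by blast
  then have "ball z e \<subseteq> closure U"
    using z'(1) closure_subset by blast
  then have "z \<in> interior (closure U)"
    using e(1) by (meson centre_in_ball interior_maximal open_ball subsetD)
  then show False
    using z'(2) U by (simp add: regular_open_def)
qed

lemma regular_open_frontier_subset_closure_Diff:
  fixes U :: "'a::euclidean_space set"
  assumes "2 \<le> DIM('a)" "regular_open U" "finite V"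
  shows "frontier U \<subseteq> closure (frontier U - V)"
proof
  fix z assume "z \<in> frontier U"
  then have "z islimpt V \<union> (frontier U - V)"
    by (intro islimpt_subset[OF regular_open_islimpt_frontier[OF assms(1,2)]]) auto
  then have "z islimpt frontier U - V"
    by (rule islimpt_Un_finite[OF assms(3), THEN iffD1])
  then show "z \<in> closure (frontier U - V)"
    by (simp add: closure_def)
qed

lemma regular_open_frontier_Diff_nonempty:
  fixes U :: "'a::euclidean_space set"
  assumes "2 \<le> DIM('a)" "regular_open U" "finite V" "U \<noteq> {}" "U \<noteq> UNIV"
  shows "frontier U - V \<noteq> {}"
  using regular_open_frontier_subset_closure_Diff[OF assms(1-3)] assms(4,5)
  by (metis closure_empty frontier_eq_empty subset_empty)

lemma finite_components_Compl_finite: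
  fixes T :: "'a::linear_continuum_topology set"
  assumes "finite T"
  shows "finite (components (- T))"
proof -
  define pick where "pick C = (SOME x. x \<in> C)" for C :: "'a set"
  have pick: "pick C \<in> C" "pick C \<notin> T" if "C \<in> components (- T)" for C
    using that in_components_nonempty in_components_subset some_in_eq unfolding pick_def by blast+
  have same: "C = D"
    if C: "C \<in> components (- T)" and D: "D \<in> components (- T)"
      and eq: "T \<inter> {..pick C} = T \<inter> {..pick D}" and "pick C \<le> pick D" for C D
  proof -
    have "t \<notin> T" if "t \<in> {pick C..pick D}" for t
      using that eq pick(2)[OF C] by (metis IntE IntI antisym atLeastAtMost_iff atMost_iff)
    then have "{pick C..pick D} \<subseteq> C"
      using pick(1)[OF C] \<open>pick C \<le> pick D\<close> by (intro components_maximal[OF C]) auto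
    then show ?thesis
      using pick(1)[OF D] \<open>pick C \<le> pick D\<close> components_eq[OF C D] by auto
  qed
  have "inj_on (\<lambda>C. T \<inter> {..pick C}) (components (- T))"
  proof (rule inj_onI)
    show "C = D"
      if "C \<in> components (- T)" "D \<in> components (- T)" "T \<inter> {..pick C} = T \<inter> {..pick D}" for C D
      using same[of C D] same[of D C] that linear[of "pick C" "pick D"] by argo
  qed
  moreover have "(\<lambda>C. T \<inter> {..pick C}) ` components (- T) \<subseteq> Pow T"
    by blast
  ultimately show ?thesis
    using assms by (meson finite_Pow_iff inj_on_finite)
qed

subsection \<open>Coordinates that straighten a plane curve\<close>

locale straightening =
  fixes f :: "real \<times> real \<Rightarrow> real" and g h :: "real \<times> real \<Rightarrow> real \<times> real"
  assumes homeo: "homeomorphism UNIV UNIV g h" and snd_g: "snd (g z) = f z"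
begin

lemma h_g [simp]: "h (g z) = z" and g_h [simp]: "g (h w) = w"
  using homeo by (simp_all add: homeomorphism_apply1 homeomorphism_apply2)

lemma continuous_g: "continuous_on S g" and continuous_h: "continuous_on T h"
  using homeo by (auto simp: homeomorphism_def intro: continuous_on_subset)

lemma h_image: "h ` A = g -` A" and g_image: "g ` A = h -` A"
  by (intro set_eqI; metis g_h h_g image_iff vimage_eq)+

lemma f_h [simp]: "f (h w) = snd w"
  by (simp flip: snd_g)

lemma continuous_f: "continuous_on S f"
  using continuous_on_snd[OF continuous_g] by (simp add: snd_g)

lemma open_h_image: "open A \<Longrightarrow> open (h ` A)"
  by (simp add: h_image open_vimage continuous_g)

lemma open_f_image:
  assumes "open A"
  shows "open (f ` A)"
proof -
  have "open (snd ` g ` A)"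
    using assms by (simp add: g_image open_vimage continuous_h open_image_snd)
  then show ?thesis
    by (simp add: image_image snd_g)
qed

lemmas closure_f_vimage = closure_vimage_open_map[OF continuous_f open_f_image]
  and interior_f_vimage = interior_vimage_open_map[OF continuous_f open_f_image]
  and regular_open_f_vimage = regular_open_vimage[OF continuous_f open_f_image]

lemma connected_image_Int_vimage:
  assumes "convex A" "convex T"
  shows "connected (h ` A \<inter> f -` T)"
proof -
  have "h ` A \<inter> f -` T = h ` (A \<inter> UNIV \<times> T)"
    by auto
  then show ?thesis
    using assms
    by (metis connected_continuous_image continuous_h convex_Int convex_Times convex_UNIV convex_connected)
qed

lemma connected_f_vimage: "convex T \<Longrightarrow> connected (f -` T)"
  using connected_image_Int_vimage[of UNIV T] by (simp add: h_image)

lemma obtain_connected_neighbourhood: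
  assumes "open W" "z \<in> W"
  obtains N where "open N" "z \<in> N" "N \<subseteq> W" "\<And>T. convex T \<Longrightarrow> connected (N \<inter> f -` T)"
proof -
  have "open (h -` W)" "g z \<in> h -` W"
    using assms by (simp_all add: open_vimage continuous_h)
  then obtain e where e: "e > 0" "ball (g z) e \<subseteq> h -` W"
    using open_contains_ball by blast
  show ?thesis
  proof
    show "open (h ` ball (g z) e)"
      by (simp add: open_h_image)
    show "z \<in> h ` ball (g z) e"
      using e(1) by (simp add: h_image)
    show "h ` ball (g z) e \<subseteq> W"
      using e(2) by blast
  qed (simp add: connected_image_Int_vimage)
qed

lemma unbounded_f_vimage:
  assumes "T \<noteq> {}"
  shows "\<not> bounded (f -` T)"
proof
  assume "bounded (f -` T)"
  then have "compact (g ` closure (f -` T))"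
    by (simp add: compact_continuous_image continuous_g)
  moreover have "UNIV \<times> T \<subseteq> g ` closure (f -` T)"
  proof
    fix w :: "real \<times> real" assume "w \<in> UNIV \<times> T"
    then have "h w \<in> closure (f -` T)"
      using closure_subset[of "f -` T"] by auto
    then show "w \<in> g ` closure (f -` T)"
      by (rule rev_image_eqI) simp
  qed
  ultimately have "bounded (fst ` (UNIV \<times> T :: (real \<times> real) set))"
    by (meson bounded_fst bounded_subset compact_imp_bounded)
  then show False
    using assms by simp
qed

definition curve :: "real \<Rightarrow> real \<times> real" where
  "curve t = h (t, 0)"

lemma continuous_curve: "continuous_on S curve"
  unfolding curve_def
  by (rule continuous_on_compose2[OF continuous_h[of UNIV]]) (simp_all add: continuous_on_Pair)

lemma inj_curve: "inj curve"
  by (rule injI) (metis curve_def fst_conv g_h)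

lemma range_curve: "range curve = f -` {0}"
proof -
  have "z = curve (fst (g z))" if "f z = 0" for z
    using that by (metis curve_def h_g snd_g prod.collapse)
  then show ?thesis
    by (auto simp: curve_def)
qed

lemma homeomorphic_curve_image: "A homeomorphic curve ` A"
proof -
  have "homeomorphism A (curve ` A) curve (\<lambda>z. fst (g z))"
    unfolding homeomorphism_def
    using continuous_curve continuous_on_fst[OF continuous_g] by (auto simp: curve_def image_image)
  then show ?thesis
    by (auto simp: homeomorphic_def)
qed

lemma closure_curve_image: "closure (curve ` A) = curve ` closure A"
proof
  have "curve ` closure A = h ` (closure A \<times> {0})"
    by (force simp: curve_def)
  then have "closed (curve ` closure A)"
    by (simp add: h_image closed_vimage closed_Times continuous_g)
  then show "closure (curve ` A) \<subseteq> curve ` closure A"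
    by (simp add: closure_minimal closure_subset image_mono)
  show "curve ` closure A \<subseteq> closure (curve ` A)"
    by (intro image_closure_subset continuous_curve) (auto simp: closure_subset)
qed

end

subsection \<open>Arrangements of finitely many straightened curves\<close>

locale curve_arrangement =
  fixes I :: "'i set" and f :: "'i \<Rightarrow> real \<times> real \<Rightarrow> real"
    and g h :: "'i \<Rightarrow> real \<times> real \<Rightarrow> real \<times> real"
  assumes finite_I: "finite I"
    and straightening: "i \<in> I \<Longrightarrow> straightening (f i) (g i) (h i)"
    and finite_curve_Int: "\<lbrakk>i \<in> I; j \<in> I; i \<noteq> j\<rbrakk> \<Longrightarrow> finite (f i -` {0} \<inter> f j -` {0})"
begin

abbreviation \<gamma> :: "'i \<Rightarrow> real \<Rightarrow> real \<times> real" where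
  "\<gamma> i \<equiv> straightening.curve (h i)"

lemmas continuous_f = straightening.continuous_f[OF straightening]
  and closure_f_vimage = straightening.closure_f_vimage[OF straightening]
  and range_\<gamma> = straightening.range_curve[OF straightening]
  and inj_\<gamma> = straightening.inj_curve[OF straightening]
  and closure_\<gamma>_image = straightening.closure_curve_image[OF straightening]
  and homeomorphic_\<gamma>_image = straightening.homeomorphic_curve_image[OF straightening]

definition X :: "(real \<times> real) set" where
  "X = (\<Inter>i\<in>I. f i -` {0<..})"

definition crossings :: "(real \<times> real) set" where
  "crossings = (\<Union>i\<in>I. \<Union>j\<in>I - {i}. f i -` {0} \<inter> f j -` {0})"

definition edges :: "(real \<times> real) set set" where
  "edges = (\<Union>i\<in>I. image (\<gamma> i) ` components (- (\<gamma> i -` crossings)))"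

definition sides :: "(real \<times> real) set \<Rightarrow> (real \<times> real) set set" where
  "sides U = closure ` {E \<in> edges. E \<subseteq> frontier U}"

lemma finite_crossings: "finite crossings"
  unfolding crossings_def using finite_I finite_curve_Int by (intro finite_UN_I) auto

lemma finite_\<gamma>_vimage_crossings: "i \<in> I \<Longrightarrow> finite (\<gamma> i -` crossings)"
  by (simp add: finite_crossings finite_vimageI inj_\<gamma>)

lemma finite_edges: "finite edges"
  unfolding edges_def
  using finite_I by (auto intro!: finite_components_Compl_finite finite_\<gamma>_vimage_crossings)

lemma finite_sides: "finite (sides U)"
  unfolding sides_def using finite_edges by simp

lemma regular_open_X: "regular_open X"
  unfolding X_def
  by (intro regular_open_INT finite_I regular_open_greaterThan
      straightening.regular_open_f_vimage[OF straightening])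

lemma closure_X_subset: "i \<in> I \<Longrightarrow> closure X \<subseteq> f i -` {0..}"
  using closure_mono[of X "f i -` {0<..}"] by (auto simp: X_def closure_f_vimage)

lemma frontier_X_subset: "frontier X \<subseteq> (\<Union>i\<in>I. f i -` {0})"
proof
  fix z assume "z \<in> frontier X"
  then have "z \<in> closure X" "z \<notin> X"
    by (simp_all add: frontier_def interior_open regular_open_imp_open[OF regular_open_X])
  then obtain i where i: "i \<in> I" "\<not> f i z > 0"
    by (auto simp: X_def)
  then have "f i z \<ge> 0"
    using \<open>z \<in> closure X\<close> closure_X_subset[of i] by auto
  then show "z \<in> (\<Union>i\<in>I. f i -` {0})"
    using i by auto
qed

lemma obtain_half_disc:
  assumes i: "i \<in> I" and z: "z \<in> f i -` {0} - crossings" "z \<in> closure X"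
  obtains N where "open N" "z \<in> N" "connected (N \<inter> X)" "N \<inter> f i -` {0} \<subseteq> closure (N \<inter> X)"
proof -
  define W where "W = (\<Inter>j\<in>I - {i}. f j -` {0<..})"
  have "f j z > 0" if j: "j \<in> I - {i}" for j
  proof -
    have "f j z \<noteq> 0"
      using i j z(1) by (auto simp: crossings_def)
    moreover have "f j z \<ge> 0"
      using closure_X_subset[of j] j z(2) by auto
    ultimately show ?thesis
      by simp
  qed
  then have "z \<in> W"
    by (simp add: W_def)
  moreover have "open W"
    unfolding W_def using finite_I by (intro open_INT ballI open_vimage continuous_f) auto
  ultimately obtain N where N: "open N" "z \<in> N" "N \<subseteq> W" "connected (N \<inter> f i -` {0<..})"
    using straightening.obtain_connected_neighbourhood[OF straightening[OF i]]
    by (metis convex_real_interval(3))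
  have NX: "N \<inter> X = N \<inter> f i -` {0<..}"
    using N(3) i by (auto simp: X_def W_def)
  show ?thesis
  proof
    show "connected (N \<inter> X)"
      unfolding NX by (rule N(4))
    have "N \<inter> f i -` {0} \<subseteq> N \<inter> closure (f i -` {0<..})"
      using i by (auto simp: closure_f_vimage)
    also have "\<dots> \<subseteq> closure (N \<inter> X)"
      unfolding NX by (rule open_Int_closure_subset[OF N(1)])
    finally show "N \<inter> f i -` {0} \<subseteq> closure (N \<inter> X)" .
  qed fact+
qed

lemma regular_open_component_X: "U \<in> components X \<Longrightarrow> regular_open U"
  by (rule regular_open_component[OF regular_open_X])

lemma closure_component_subset: "U \<in> components X \<Longrightarrow> closure U \<subseteq> closure X"
  by (intro closure_mono in_components_subset)

lemma obtain_half_disc_in_component: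
  assumes U: "U \<in> components X" "z \<in> closure U" and i: "i \<in> I" "z \<in> f i -` {0} - crossings"
  obtains N where "open N" "z \<in> N" "N \<inter> X \<subseteq> U" "N \<inter> f i -` {0} \<subseteq> closure U"
proof -
  obtain N where N: "open N" "z \<in> N" "connected (N \<inter> X)" "N \<inter> f i -` {0} \<subseteq> closure (N \<inter> X)"
    using obtain_half_disc[OF i] U closure_component_subset by blast
  have "N \<inter> U \<noteq> {}"
    using N(1,2) U(2) open_Int_closure_eq_empty by blast
  then have sub: "N \<inter> X \<subseteq> U"
    using in_components_subset[OF U(1)] by (intro components_maximal[OF U(1) N(3)]) auto
  show ?thesis
  proof
    show "N \<inter> f i -` {0} \<subseteq> closure U"
      using N(4) closure_mono[OF sub] by (rule subset_trans)
  qed fact+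
qed

lemma component_Int_subset_X_nonempty:
  assumes "U \<in> components X" "z \<in> closure U" "i \<in> I" "z \<in> f i -` {0} - crossings"
    and W: "W \<subseteq> X" "z \<in> closure W"
  shows "U \<inter> W \<noteq> {}"
proof -
  obtain N where N: "open N" "z \<in> N" "N \<inter> X \<subseteq> U"
    using obtain_half_disc_in_component[OF assms(1-4)] .
  then have "N \<inter> W \<noteq> {}"
    using W(2) open_Int_closure_eq_empty by blast
  then show ?thesis
    using N(3) W(1) by blast
qed

lemma edge_cases:
  assumes "E \<in> edges"
  obtains i C where "i \<in> I" "C \<in> components (- (\<gamma> i -` crossings))" "E = \<gamma> i ` C"
  using assms unfolding edges_def by blast

lemma edge_nonempty: "E \<in> edges \<Longrightarrow> E \<noteq> {}"
  by (metis edge_cases image_is_empty in_components_nonempty)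

lemma edge_connected: "E \<in> edges \<Longrightarrow> connected E"
  by (metis edge_cases homeomorphic_\<gamma>_image homeomorphic_connectedness in_components_connected)

lemma obtain_edge_curve:
  assumes "E \<in> edges"
  obtains i where "i \<in> I" "E \<subseteq> f i -` {0} - crossings"
proof -
  obtain i C where "i \<in> I" "C \<in> components (- (\<gamma> i -` crossings))" "E = \<gamma> i ` C"
    using assms by (rule edge_cases)
  then show ?thesis
    using that[of i] range_\<gamma>[of i] in_components_subset by blast
qed

lemma obtain_edge_through:
  assumes "i \<in> I" "z \<in> f i -` {0} - crossings"
  obtains E where "E \<in> edges" "z \<in> E"
proof -
  obtain t where t: "z = \<gamma> i t"
    using assms range_\<gamma>[of i] by blast
  then have "t \<in> - (\<gamma> i -` crossings)"
    using assms(2) by simp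
  then obtain C where "C \<in> components (- (\<gamma> i -` crossings))" "t \<in> C"
    by (metis UnionE Union_components)
  then show ?thesis
    using that[of "\<gamma> i ` C"] assms(1) t by (auto simp: edges_def)
qed

lemma disjoint_edges:
  assumes E: "E \<in> edges" and F: "F \<in> edges" and "E \<noteq> F"
  shows "E \<inter> F = {}"
proof -
  obtain i C where C: "i \<in> I" "C \<in> components (- (\<gamma> i -` crossings))" "E = \<gamma> i ` C"
    using E by (rule edge_cases)
  obtain j D where D: "j \<in> I" "D \<in> components (- (\<gamma> j -` crossings))" "F = \<gamma> j ` D"
    using F by (rule edge_cases)
  show ?thesis
  proof (cases "i = j")
    case True
    then have "C \<inter> D = {}"
      using C D \<open>E \<noteq> F\<close> components_nonoverlap by metis
    then show ?thesis
      using C D True image_Int[OF inj_\<gamma>[OF C(1)], of C D] by simp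
  next
    case False
    have "E \<subseteq> f i -` {0} - crossings" "F \<subseteq> f j -` {0} - crossings"
      using C D range_\<gamma> in_components_subset by blast+
    then show ?thesis
      using False C(1) D(1) unfolding crossings_def by blast
  qed
qed

lemma closure_edge_subset:
  assumes "E \<in> edges"
  shows "closure E \<subseteq> E \<union> crossings"
proof -
  obtain i C where C: "i \<in> I" "C \<in> components (- (\<gamma> i -` crossings))" "E = \<gamma> i ` C"
    using assms by (rule edge_cases)
  then have "- (\<gamma> i -` crossings) \<inter> closure C = C"
    by (intro component_Int_closure)
  then show ?thesis
    using C(1,3) by (auto simp: closure_\<gamma>_image)
qed

lemma finite_Int_closure_edges:
  assumes "E \<in> edges" "F \<in> edges" "E \<noteq> F"
  shows "finite (closure E \<inter> closure F)"
proof (rule finite_subset[OF _ finite_crossings])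
  show "closure E \<inter> closure F \<subseteq> crossings"
    using closure_edge_subset[OF assms(1)] closure_edge_subset[OF assms(2)] disjoint_edges[OF assms] by blast
qed

lemma is_arc_closure_edge:
  assumes "E \<in> edges"
  shows "is_arc (closure E)"
proof -
  obtain i C where C: "i \<in> I" "C \<in> components (- (\<gamma> i -` crossings))" "E = \<gamma> i ` C"
    using assms by (rule edge_cases)
  have "open C"
    using C(1,2) finite_imp_closed[OF finite_\<gamma>_vimage_crossings] by (meson open_Compl open_components)
  then have "infinite C"
    using in_components_nonempty[OF C(2)] finite_imp_not_open by blast
  then obtain a b where "a \<in> C" "b \<in> C" "a \<noteq> b"
    by (metis finite.emptyI finite.insertI finite_subset insertCI subsetI)
  moreover have "is_interval (closure C)"
    using in_components_connected[OF C(2)]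
    by (simp add: is_interval_connected_1 connected_imp_connected_closure)
  ultimately show ?thesis
    using C(1,3) closure_subset homeomorphic_\<gamma>_image[of i "closure C"]
    unfolding is_arc_def by (metis closure_\<gamma>_image subsetD)
qed

lemma is_arc_side: "A \<in> sides U \<Longrightarrow> is_arc A"
  by (auto simp: sides_def is_arc_closure_edge)

lemma obtain_side_curve:
  assumes "A \<in> sides U"
  obtains i where "i \<in> I" "A \<subseteq> f i -` {0}"
proof -
  obtain E where E: "E \<in> edges" "A = closure E"
    using assms by (auto simp: sides_def)
  obtain i where i: "i \<in> I" "E \<subseteq> f i -` {0} - crossings"
    using E(1) by (rule obtain_edge_curve)
  have "closed (f i -` {0})"
    using i(1) by (simp add: closed_vimage continuous_f)
  then have "A \<subseteq> f i -` {0}"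
    unfolding E(2) using i(2) by (intro closure_minimal) auto
  then show ?thesis
    using that i(1) by blast
qed

lemma frontier_component_subset: "U \<in> components X \<Longrightarrow> frontier U \<subseteq> (\<Union>i\<in>I. f i -` {0})"
  using frontier_of_components_subset frontier_X_subset by blast

lemma edge_subset_frontier:
  assumes U: "U \<in> components X" and E: "E \<in> edges" and meets: "E \<inter> closure U \<noteq> {}"
  shows "E \<subseteq> frontier U"
proof -
  obtain i where i: "i \<in> I" "E \<subseteq> f i -` {0} - crossings"
    using E by (rule obtain_edge_curve)
  have "openin (top_of_set E) (E \<inter> closure U)"
  proof (subst openin_subopen, intro ballI)
    fix z assume z: "z \<in> E \<inter> closure U"
    then have "z \<in> closure U" "z \<in> f i -` {0} - crossings"
      using i(2) by blast+
    then obtain N where "open N" "z \<in> N" "N \<inter> X \<subseteq> U" "N \<inter> f i -` {0} \<subseteq> closure U"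
      by (rule obtain_half_disc_in_component[OF U _ i(1)])
    then show "\<exists>T. openin (top_of_set E) T \<and> z \<in> T \<and> T \<subseteq> E \<inter> closure U"
      using z i(2) by (intro exI[of _ "E \<inter> N"]) (auto simp: openin_open_Int)
  qed
  moreover have "closedin (top_of_set E) (E \<inter> closure U)"
    by (simp add: closedin_closed_Int)
  ultimately have "E \<subseteq> closure U"
    using edge_connected[OF E] meets unfolding connected_clopen by blast
  moreover have "E \<inter> U = {}"
    using i in_components_subset[OF U] by (force simp: X_def)
  ultimately show ?thesis
    using regular_open_imp_open[OF regular_open_component_X[OF U]] by (auto simp: frontier_def interior_open)
qed

lemma obtain_frontier_edge:
  assumes U: "U \<in> components X" and z: "z \<in> frontier U - crossings"
  obtains E where "E \<in> edges" "z \<in> E" "E \<subseteq> frontier U"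
proof -
  obtain i where "i \<in> I" "z \<in> f i -` {0} - crossings"
    using z frontier_component_subset[OF U] by blast
  then obtain E where E: "E \<in> edges" "z \<in> E"
    by (rule obtain_edge_through)
  then have "E \<subseteq> frontier U"
    using z by (intro edge_subset_frontier[OF U]) (auto simp: frontier_def)
  then show ?thesis
    using that E by blast
qed

lemma frontier_component:
  assumes U: "U \<in> components X"
  shows "frontier U = \<Union>(sides U)"
proof
  have "frontier U \<subseteq> closure (frontier U - crossings)"
    using regular_open_component_X[OF U] finite_crossings
    by (intro regular_open_frontier_subset_closure_Diff) simp_all
  also have "\<dots> \<subseteq> \<Union>(sides U)"
  proof (rule closure_minimal)
    show "closed (\<Union>(sides U))"
      using finite_sides by (intro closed_Union) (auto simp: sides_def)
    show "frontier U - crossings \<subseteq> \<Union>(sides U)"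
    proof
      fix z assume "z \<in> frontier U - crossings"
      then obtain E where "E \<in> edges" "z \<in> E" "E \<subseteq> frontier U"
        by (rule obtain_frontier_edge[OF U])
      then show "z \<in> \<Union>(sides U)"
        using closure_subset by (fastforce simp: sides_def)
    qed
  qed
  finally show "frontier U \<subseteq> \<Union>(sides U)" .
  show "\<Union>(sides U) \<subseteq> frontier U"
    by (auto simp: sides_def dest: subsetD[OF closure_minimal[OF _ frontier_closed]])
qed

lemma edge_determines_component:
  assumes U: "U \<in> components X" and W: "W \<in> components X"
    and E: "E \<in> edges" "E \<subseteq> frontier U" "E \<subseteq> frontier W"
  shows "U = W"
proof -
  obtain i where i: "i \<in> I" "E \<subseteq> f i -` {0} - crossings"
    using E(1) by (rule obtain_edge_curve)
  obtain z where "z \<in> E"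
    using edge_nonempty[OF E(1)] by blast
  then have "U \<inter> W \<noteq> {}"
    using i E(2,3) in_components_subset[OF W]
    by (intro component_Int_subset_X_nonempty[OF U, of z i]) (auto simp: frontier_def)
  then show ?thesis
    using components_eq[OF U W] by blast
qed

lemma finite_components_X: "finite (components X)"
proof -
  have "\<exists>E\<in>edges. E \<subseteq> frontier U" if U: "U \<in> components X - {UNIV}" for U
  proof -
    have "frontier U - crossings \<noteq> {}"
      using U in_components_nonempty[of U X]
      by (intro regular_open_frontier_Diff_nonempty regular_open_component_X finite_crossings) auto
    then show ?thesis
      using U by (meson DiffD1 ex_in_conv obtain_frontier_edge)
  qed
  then obtain E where E: "\<And>U. U \<in> components X - {UNIV} \<Longrightarrow> E U \<in> edges \<and> E U \<subseteq> frontier U"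
    by metis
  have "inj_on E (components X - {UNIV})"
  proof (rule inj_onI)
    show "U = W" if "U \<in> components X - {UNIV}" "W \<in> components X - {UNIV}" "E U = E W" for U W
      using that E[of U] E[of W] by (intro edge_determines_component[of U W "E U"]) auto
  qed
  moreover have "E ` (components X - {UNIV}) \<subseteq> edges"
    using E by blast
  ultimately have "finite (components X - {UNIV})"
    using finite_edges inj_on_finite by blast
  then show ?thesis
    by simp
qed

lemma ANR_closure_component:
  assumes U: "U \<in> components X"
  shows "ANR (closure U)"
proof (rule ANR_from_Un_Int)
  have "open U"
    using regular_open_component_X[OF U] by (rule regular_open_imp_open)
  then show "closed (- U)"
    by (rule closed_Compl)
  have "closure U \<union> - U = UNIV"
    using closure_subset by blast
  then show "ANR (closure U \<union> - U)"
    by simp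
  have "finite (A \<inter> B)" if "A \<in> sides U" "B \<in> sides U" "A \<noteq> B" for A B
    using that finite_Int_closure_edges by (auto simp: sides_def)
  then have "ANR (\<Union>(sides U))"
    using finite_sides is_arc_imp_ANR is_arc_side by (intro ANR_Union_finite_Int) (auto simp: sides_def)
  then show "ANR (closure U \<inter> - U)"
    using frontier_component[OF U] \<open>open U\<close> by (simp add: frontier_def interior_open Diff_eq)
qed simp

lemma component_Compl_closure_subset_X:
  assumes U: "U \<in> components X" and W: "W \<in> components (- closure U)" and "bounded W"
  shows "W \<subseteq> X"
proof -
  have "W \<subseteq> f i -` {0<..}" if i: "i \<in> I" for i
  proof -
    note straight = straightening[OF i]
    have "W \<inter> f i -` {..<0} = {}"
    proof (rule ccontr)
      assume meets: "W \<inter> f i -` {..<0} \<noteq> {}"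
      have "connected (f i -` {..<0})"
        by (simp add: straightening.connected_f_vimage[OF straight])
      moreover have "f i -` {..<0} \<subseteq> - closure U"
        using closure_component_subset[OF U] closure_X_subset[OF i] by fastforce
      ultimately have "f i -` {..<0} \<subseteq> W"
        using components_maximal[OF W] meets by blast
      with \<open>bounded W\<close> have "bounded (f i -` {..<0})"
        by (rule bounded_subset)
      then show False
        using straightening.unbounded_f_vimage[OF straight, of "{..<0}"] by simp
    qed
    then have "W \<subseteq> f i -` {0..}"
      by (auto simp: not_less[symmetric])
    moreover have "open W"
      using W by (meson closed_closure open_Compl open_components)
    ultimately have "W \<subseteq> interior (f i -` {0..})"
      by (rule interior_maximal)
    then show ?thesis
      by (simp add: straightening.interior_f_vimage[OF straight])
  qed
  then show ?thesis
    by (auto simp: X_def)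
qed

lemma unbounded_component_Compl_closure:
  assumes U: "U \<in> components X" and W: "W \<in> components (- closure U)"
  shows "\<not> bounded W"
proof
  assume bounded: "bounded W"
  have "regular_open W"
    using regular_open_component[OF regular_open_Compl_closure[OF regular_open_component_X[OF U]] W] .
  moreover have "W \<noteq> {}" "W \<noteq> UNIV"
    using W in_components_nonempty bounded by auto
  ultimately have "frontier W - crossings \<noteq> {}"
    by (intro regular_open_frontier_Diff_nonempty finite_crossings) simp_all
  then obtain z where z: "z \<in> frontier W - crossings"
    by blast
  have "frontier W \<subseteq> frontier U"
    using frontier_of_components_subset[OF W] frontier_closure_regular_open[OF regular_open_component_X[OF U]]
    by simp
  then have zU: "z \<in> frontier U" "z \<in> closure U" "z \<in> closure W"
    using z by (auto simp: frontier_def)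
  then obtain i where i: "i \<in> I" "z \<in> f i -` {0} - crossings"
    using frontier_component_subset[OF U] z by blast
  have "U \<inter> W \<noteq> {}"
    using component_Int_subset_X_nonempty[OF U zU(2) i component_Compl_closure_subset_X[OF U W bounded] zU(3)] .
  then show False
    using in_components_subset[OF W] closure_subset by blast
qed

lemma region_typeI_closure_component:
  assumes U: "U \<in> components X"
    and graph: "\<And>i. i \<in> I \<Longrightarrow> \<exists>p \<theta>. f i -` {0} \<subseteq> rot_poly_graph p \<theta>"
  shows "region_typeI (closure U)"
  unfolding region_typeI_def
proof (intro conjI)
  note regular = regular_open_component_X[OF U]
  show "connected (closure U)"
    using in_components_connected[OF U] by (rule connected_imp_connected_closure)
  then show "simply_connected (closure U)"
    using ANR_closure_component[OF U] unbounded_component_Compl_closure[OF U]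
    by (intro simply_connected_closed_ANR_2D) auto
  show "closure (interior (closure U)) = closure U"
    using regular by (simp add: regular_open_def)
  have "\<exists>p \<theta>. A \<subseteq> rot_poly_graph p \<theta>" if "A \<in> sides U" for A
    using that graph by (meson obtain_side_curve subset_trans)
  then show "\<exists>S. finite S \<and> frontier (closure U) = \<Union>S
      \<and> (\<forall>A\<in>S. is_arc A \<and> (\<exists>p \<theta>. A \<subseteq> rot_poly_graph p \<theta>))"
    using finite_sides is_arc_side frontier_component[OF U] frontier_closure_regular_open[OF regular]
    by (intro exI[of _ "sides U"]) auto
qed simp

lemma region_typeII_component:
  assumes "U \<in> components X" and "\<And>i. i \<in> I \<Longrightarrow> \<exists>p \<theta>. f i -` {0} \<subseteq> rot_poly_graph p \<theta>"
  shows "region_typeII U"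
  using region_typeI_closure_component[OF assms] regular_open_component_X[OF assms(1)]
  unfolding region_typeII_def regular_open_def by blast

end

subsection \<open>Rotated polynomial graphs\<close>

definition rotated_coords :: "real \<Rightarrow> real \<times> real \<Rightarrow> real \<times> real" where
  "rotated_coords \<theta> z = (fst z * cos \<theta> + snd z * sin \<theta>, - fst z * sin \<theta> + snd z * cos \<theta>)"

definition shear :: "real poly \<Rightarrow> real \<times> real \<Rightarrow> real \<times> real" where
  "shear p w = (fst w, poly p (fst w) - snd w)"

lemma rotated_coords_uminus: "rotated_coords (- \<theta>) (rotated_coords \<theta> z) = z"
proof -
  have "fst z * cos \<theta> * cos \<theta> + fst z * sin \<theta> * sin \<theta> = fst z"
      "snd z * cos \<theta> * cos \<theta> + snd z * sin \<theta> * sin \<theta> = snd z"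
    using sin_cos_squared_add[of \<theta>] by algebra+
  then show ?thesis
    by (simp add: rotated_coords_def prod_eq_iff algebra_simps)
qed

lemma homeomorphism_rotated_coords:
  "homeomorphism UNIV UNIV (rotated_coords \<theta>) (rotated_coords (- \<theta>))"
proof (rule homeomorphismI)
  show "continuous_on UNIV (rotated_coords \<theta>)" "continuous_on UNIV (rotated_coords (- \<theta>))"
    unfolding rotated_coords_def by (intro continuous_intros)+
  show "rotated_coords \<theta> (rotated_coords (- \<theta>) w) = w" for w
    using rotated_coords_uminus[of "- \<theta>"] by simp
qed (simp_all add: rotated_coords_uminus)

lemma homeomorphism_shear: "homeomorphism UNIV UNIV (shear p) (shear p)"
proof (rule homeomorphismI)
  show "continuous_on UNIV (shear p)" "continuous_on UNIV (shear p)"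
    unfolding shear_def by (intro continuous_intros)+
qed (simp_all add: shear_def)

lemma straightening_Phi:
  "straightening (Phi p \<theta>) (shear p \<circ> rotated_coords \<theta>) (rotated_coords (- \<theta>) \<circ> shear p)"
proof
  show "homeomorphism UNIV UNIV (shear p \<circ> rotated_coords \<theta>) (rotated_coords (- \<theta>) \<circ> shear p)"
    using homeomorphism_compose[OF homeomorphism_rotated_coords homeomorphism_shear] .
  show "snd ((shear p \<circ> rotated_coords \<theta>) z) = Phi p \<theta> z" for z
    by (simp add: shear_def rotated_coords_def Phi_def)
qed

lemma rot_poly_graph_eq_vimage: "rot_poly_graph p \<theta> = Phi p \<theta> -` {0}"
  by (auto simp: rot_poly_graph_def)

lemma rot_poly_graph_eq_range: "rot_poly_graph p \<theta> = range (\<lambda>t. rotated_coords (- \<theta>) (t, poly p t))"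
  using straightening.range_curve[OF straightening_Phi[of p \<theta>]]
  by (simp add: rot_poly_graph_eq_vimage straightening.curve_def[OF straightening_Phi] shear_def)

lemma Phi_on_rot_poly_graph_poly:
  obtains r where "\<And>t. Phi q \<phi> (rotated_coords (- \<theta>) (t, poly p t)) = poly r t"
proof -
  define x where "x = [:0, cos \<theta>:] - smult (sin \<theta>) p"
  define y where "y = [:0, sin \<theta>:] + smult (cos \<theta>) p"
  have "Phi q \<phi> (rotated_coords (- \<theta>) (t, poly p t)) =
      poly (pcompose q (smult (cos \<phi>) x + smult (sin \<phi>) y) - (smult (cos \<phi>) y - smult (sin \<phi>) x)) t" for t
    by (simp add: Phi_def rotated_coords_def poly_pcompose x_def y_def algebra_simps)
  then show ?thesis
    using that by blast
qed

lemma rot_poly_graph_Int_finite_or_subset: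
  "finite (rot_poly_graph p \<theta> \<inter> rot_poly_graph q \<phi>) \<or> rot_poly_graph p \<theta> \<subseteq> rot_poly_graph q \<phi>"
proof -
  let ?c = "\<lambda>t. rotated_coords (- \<theta>) (t, poly p t)"
  obtain r where r: "\<And>t. Phi q \<phi> (?c t) = poly r t"
    using Phi_on_rot_poly_graph_poly by blast
  show ?thesis
  proof (cases "r = 0")
    case True
    then have "rot_poly_graph p \<theta> \<subseteq> rot_poly_graph q \<phi>"
      using r unfolding rot_poly_graph_eq_range[of p] by (auto simp: rot_poly_graph_def)
    then show ?thesis ..
  next
    case False
    have "rot_poly_graph p \<theta> \<inter> rot_poly_graph q \<phi> \<subseteq> ?c ` {t. poly r t = 0}"
      using r unfolding rot_poly_graph_eq_range[of p] by (auto simp: rot_poly_graph_def)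
    then show ?thesis
      using False poly_roots_finite finite_subset by blast
  qed
qed

lemma connected_subset_positive_side:
  fixes f :: "'a::topological_space \<Rightarrow> real"
  assumes "connected A" "continuous_on A f" "f -` {0} \<inter> A = {}" "x \<in> A" "f x > 0"
  shows "A \<subseteq> f -` {0<..}"
proof
  fix y assume "y \<in> A"
  have "0 \<notin> f ` A"
    using assms(3) by auto
  then have "\<not> f y \<le> 0"
    using connectedD_interval[OF connected_continuous_image[OF assms(2,1)], of "f y" "f x" 0] assms(4,5) \<open>y \<in> A\<close>
    by auto
  then show "y \<in> f -` {0<..}"
    by simp
qed

lemma poly_half_plane_subsetI:
  assumes "rot_poly_graph q \<phi> \<subseteq> rot_poly_graph p \<theta>" "x \<in> poly_half_plane p \<theta> \<inter> poly_half_plane q \<phi>"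
  shows "poly_half_plane p \<theta> \<subseteq> poly_half_plane q \<phi>"
proof -
  have "connected (Phi p \<theta> -` {0<..})"
    by (simp add: straightening.connected_f_vimage[OF straightening_Phi])
  moreover have "Phi q \<phi> -` {0} \<inter> Phi p \<theta> -` {0<..} = {}"
    using assms(1) by (force simp: rot_poly_graph_def)
  ultimately have "Phi p \<theta> -` {0<..} \<subseteq> Phi q \<phi> -` {0<..}"
    using straightening.continuous_f[OF straightening_Phi] assms(2)
    by (intro connected_subset_positive_side[of _ _ x]) (auto simp: poly_half_plane_def)
  then show ?thesis
    by (auto simp: poly_half_plane_def)
qed

lemma finite_rot_poly_graph_Int:
  assumes "poly_half_plane p \<theta> \<noteq> poly_half_plane q \<phi>" "poly_half_plane p \<theta> \<inter> poly_half_plane q \<phi> \<noteq> {}"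
  shows "finite (rot_poly_graph p \<theta> \<inter> rot_poly_graph q \<phi>)"
proof (rule ccontr)
  assume "infinite (rot_poly_graph p \<theta> \<inter> rot_poly_graph q \<phi>)"
  then have "rot_poly_graph p \<theta> \<subseteq> rot_poly_graph q \<phi>" "rot_poly_graph q \<phi> \<subseteq> rot_poly_graph p \<theta>"
    using rot_poly_graph_Int_finite_or_subset[of p \<theta> q \<phi>] rot_poly_graph_Int_finite_or_subset[of q \<phi> p \<theta>]
    by (simp_all add: Int_commute)
  then have "poly_half_plane p \<theta> = poly_half_plane q \<phi>"
    using assms(2) by (blast dest: poly_half_plane_subsetI)
  then show False
    using assms(1) by contradiction
qed

lemma curve_arrangement_Phi:
  assumes "finite I" and common_point: "(\<Inter>i\<in>I. poly_half_plane (p i) (\<theta> i)) \<noteq> {}"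
    and distinct: "\<And>i j. \<lbrakk>i \<in> I; j \<in> I; i \<noteq> j\<rbrakk> \<Longrightarrow> poly_half_plane (p i) (\<theta> i) \<noteq> poly_half_plane (p j) (\<theta> j)"
  shows "curve_arrangement I (\<lambda>i. Phi (p i) (\<theta> i))
    (\<lambda>i. shear (p i) \<circ> rotated_coords (\<theta> i)) (\<lambda>i. rotated_coords (- \<theta> i) \<circ> shear (p i))"
proof (intro curve_arrangement.intro straightening_Phi)
  show "finite (Phi (p i) (\<theta> i) -` {0} \<inter> Phi (p j) (\<theta> j) -` {0})"
    if "i \<in> I" "j \<in> I" "i \<noteq> j" for i j
    unfolding rot_poly_graph_eq_vimage[symmetric]
    using that common_point distinct[OF that] by (intro finite_rot_poly_graph_Int) auto
qed fact

theorem theorem4p3: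
  fixes k :: nat and p :: "nat \<Rightarrow> real poly" and \<theta> :: "nat \<Rightarrow> real"
  assumes "\<forall>i<k. \<forall>j<k. i \<noteq> j \<longrightarrow> poly_half_plane (p i) (\<theta> i) \<noteq> poly_half_plane (p j) (\<theta> j)"
  shows "\<exists>F. finite F \<and> pairwise disjnt F \<and> (\<forall>U\<in>F. region_typeII U)
             \<and> \<Union>F = (\<Inter>i\<in>{..<k}. poly_half_plane (p i) (\<theta> i))"
proof (cases "(\<Inter>i\<in>{..<k}. poly_half_plane (p i) (\<theta> i)) = {}")
  case True
  then show ?thesis
    by (intro exI[of _ "{}"]) auto
next
  case False
  interpret curve_arrangement "{..<k}" "\<lambda>i. Phi (p i) (\<theta> i)"
    "\<lambda>i. shear (p i) \<circ> rotated_coords (\<theta> i)" "\<lambda>i. rotated_coords (- \<theta> i) \<circ> shear (p i)"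
    using assms False by (intro curve_arrangement_Phi) auto
  have "region_typeII U" if "U \<in> components X" for U
    using that rot_poly_graph_eq_vimage by (intro region_typeII_component) auto
  moreover have "X = (\<Inter>i\<in>{..<k}. poly_half_plane (p i) (\<theta> i))"
    by (auto simp: X_def poly_half_plane_def)
  ultimately show ?thesis
    using finite_components_X pairwise_disjoint_components[of X] Union_components[of X]
    by (intro exI[of _ "components X"]) (auto simp: disjnt_def pairwise_def)
qed

end
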